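(* Let $\Lambda=\{\lambda_n\}_{n\ge 1}$ be a sequence of real numbers with $1<\lambda_1\le\lambda_2\le\cdots$, $\lim_{n\to\infty}\lambda_n=\infty$ and $\sum_{n=1}^{\infty}1/\lambda_n=\infty$. Let $\{p(n)\}_{n\ge1}$ be an increasing sequence of real numbers with $p(n)\ge 1$ for all $n$ and $p(n)\to\infty$ as $n\to\infty$. Then $\Lambda^{\#}BV\subset BV^{\#}(p(n)\uparrow\infty)$ if and only if $$\limsup_{n\to\infty}\ \sup_{1\le m\le 2^{n}}\ \frac{m^{1/p(n)}}{\sum_{j=1}^{m}(1/\lambda_j)}<\infty,$$ where $m$ ranges over positive integers.
   Context: All functions $f$ are real-valued measurable functions on $\mathbb{R}^2$ that are $1$-periodic in each variable. Let $I=[0,1]$. For an interval $J$ with endpoints $a<b$ and a point $x$ or $y$, put $f(J,y)=f(b,y)-f(a,y)$ and $f(x,J)=f(x,b)-f(x,a)$. Class $\Lambda^{\#}BV$: let $\Omega$ be the set of all (finite or countable) collections $\{I_i\}$ of nonoverlapping subintervals of $I$, indexed in arbitrary order. Define $$\Lambda^{\#}V_1(f)=\sup_{\{y_i\}\subset I}\ \sup_{\{I_i\}\in\Omega}\ \sum_i\frac{|f(I_i,y_i)|}{\lambda_i},\qquad \Lambda^{\#}V_2(f)=\sup_{\{x_j\}\subset I}\ \sup_{\{J_j\}\in\Omega}\ \sum_j\frac{|f(x_j,J_j)|}{\lambda_j}.$$ Then $f\in\Lambda^{\#}BV$ if $\Lambda^{\#}V_1(f)+\Lambda^{\#}V_2(f)<\infty$.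 Class $BV^{\#}(p(n)\uparrow\infty)$: a partition with period $1$ is a strictly increasing doubly infinite sequence $\Delta:\ \cdots<t_{-1}<t_0<t_1<\cdots$ of reals for which there is a positive integer $m$ (depending on $\Delta$) with $t_{k+m}=t_k+1$ for all $k\in\mathbb{Z}$; its intervals are $I_i=(t_{i-1},t_i)$, $i=1,\dots,m$, of length $|I_i|=t_i-t_{i-1}$. Define $$V_1^{\#}(f,p(n)\uparrow\infty)=\sup_{\{y_i\}\subset I}\ \sup_{n\ge1}\ \sup_{\Delta}\Big\{\Big(\sum_{i=1}^{m}|f(I_i,y_i)|^{p(n)}\Big)^{1/p(n)}:\ \inf_i|I_i|\ge 2^{-n}\Big\},$$ $$V_2^{\#}(f,p(n)\uparrow\infty)=\sup_{\{x_j\}\subset I}\ \sup_{n\ge1}\ \sup_{\Delta}\Big\{\Big(\sum_{j=1}^{m}|f(x_j,I_j)|^{p(n)}\Big)^{1/p(n)}:\ \inf_j|I_j|\ge 2^{-n}\Big\},$$ the suprema over $\Delta$ being over all partitions with period $1$ satisfying the stated length condition. Then $f\in BV^{\#}(p(n)\uparrow\infty)$ if both $V_1^{\#}(f,p(n)\uparrow\infty)$ and $V_2^{\#}(f,p(n)\uparrow\infty)$ are finite. *)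

theory Defs
  imports "HOL-Analysis.Analysis"
begin

text \<open>Measurable means Lebesgue measurable on the plane.\<close>

definition periodic_measurable :: "(real \<times> real \<Rightarrow> real) set" where
  "periodic_measurable =
     {f. f \<in> borel_measurable lebesgue \<and>
         (\<forall>x y. f (x + 1, y) = f (x, y) \<and> f (x, y + 1) = f (x, y))}"

text \<open>An interval with endpoints \<open>a < b\<close> is represented by the pair \<open>(a, b)\<close>: the
  increments of \<open>f\<close> depend on the endpoints only.\<close>

definition incr1 :: "(real \<times> real \<Rightarrow> real) \<Rightarrow> real \<times> real \<Rightarrow> real \<Rightarrow> real" where
  "incr1 f J y = f (snd J, y) - f (fst J, y)"

definition incr2 :: "(real \<times> real \<Rightarrow> real) \<Rightarrow> real \<Rightarrow> real \<times> real \<Rightarrow> real" where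
  "incr2 f x J = f (x, snd J) - f (x, fst J)"

text \<open>Collections of nonoverlapping (that is, with disjoint interiors) subintervals of
  \<open>[0,1]\<close>. The index set \<open>N\<close> is \<open>{1..k}\<close> for a finite collection and \<open>{1..}\<close> for an infinite
  one; as \<open>J\<close> is an arbitrary enumeration, every ordering of a collection occurs.\<close>

definition interval_collections :: "(nat set \<times> (nat \<Rightarrow> real \<times> real)) set" where
  "interval_collections =
     {(N, J). (N = {1..} \<or> (\<exists>k. N = {1..k})) \<and>
        (\<forall>i\<in>N. 0 \<le> fst (J i) \<and> fst (J i) < snd (J i) \<and> snd (J i) \<le> 1) \<and>
        (\<forall>i\<in>N. \<forall>j\<in>N. i \<noteq> j \<longrightarrow>
           {fst (J i)<..<snd (J i)} \<inter> {fst (J j)<..<snd (J j)} = {})}"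

definition LambdaV1 :: "(nat \<Rightarrow> real) \<Rightarrow> (real \<times> real \<Rightarrow> real) \<Rightarrow> ennreal" where
  "LambdaV1 lam f =
     (SUP y \<in> (UNIV :: nat set) \<rightarrow> {0..1}. SUP (N, J) \<in> interval_collections.
        \<Sum>\<^sub>\<infinity>i\<in>N. ennreal (\<bar>incr1 f (J i) (y i)\<bar> / lam i))"

definition LambdaV2 :: "(nat \<Rightarrow> real) \<Rightarrow> (real \<times> real \<Rightarrow> real) \<Rightarrow> ennreal" where
  "LambdaV2 lam f =
     (SUP x \<in> (UNIV :: nat set) \<rightarrow> {0..1}. SUP (N, J) \<in> interval_collections.
        \<Sum>\<^sub>\<infinity>j\<in>N. ennreal (\<bar>incr2 f (x j) (J j)\<bar> / lam j))"

definition LambdaBV :: "(nat \<Rightarrow> real) \<Rightarrow> (real \<times> real \<Rightarrow> real) set" where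
  "LambdaBV lam = {f \<in> periodic_measurable. LambdaV1 lam f + LambdaV2 lam f < \<infinity>}"

text \<open>The number \<open>m\<close> of intervals per period is carried along with the partition \<open>t\<close>;
  it is determined by \<open>t\<close>, since \<open>t\<close> is strictly increasing.\<close>

definition period_partitions :: "((int \<Rightarrow> real) \<times> nat) set" where
  "period_partitions =
     {(t, m). strict_mono t \<and> 0 < m \<and> (\<forall>k. t (k + int m) = t k + 1)}"

definition fine_partitions :: "nat \<Rightarrow> ((int \<Rightarrow> real) \<times> nat) set" where
  "fine_partitions n =
     {(t, m) \<in> period_partitions. (INF i\<in>{1..int m}. t i - t (i - 1)) \<ge> 1 / 2 ^ n}"

definition BVV1 :: "(nat \<Rightarrow> real) \<Rightarrow> (real \<times> real \<Rightarrow> real) \<Rightarrow> ennreal" where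
  "BVV1 p f =
     (SUP y \<in> (UNIV :: int set) \<rightarrow> {0..1}. SUP n \<in> {1..}. SUP (t, m) \<in> fine_partitions n.
        ennreal ((\<Sum>i=1..int m. \<bar>incr1 f (t (i - 1), t i) (y i)\<bar> powr p n) powr (1 / p n)))"

definition BVV2 :: "(nat \<Rightarrow> real) \<Rightarrow> (real \<times> real \<Rightarrow> real) \<Rightarrow> ennreal" where
  "BVV2 p f =
     (SUP x \<in> (UNIV :: int set) \<rightarrow> {0..1}. SUP n \<in> {1..}. SUP (t, m) \<in> fine_partitions n.
        ennreal ((\<Sum>j=1..int m. \<bar>incr2 f (x j) (t (j - 1), t j)\<bar> powr p n) powr (1 / p n)))"

definition BVsharp :: "(nat \<Rightarrow> real) \<Rightarrow> (real \<times> real \<Rightarrow> real) set" where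
  "BVsharp p = {f \<in> periodic_measurable. BVV1 p f < \<infinity> \<and> BVV2 p f < \<infinity>}"

end

theory Submission
  imports Defs
begin

text \<open>For sufficiency, sort the increments over a partition decreasingly, \<open>a 1 \<ge> a 2 \<ge> \<dots>\<close>.
  With \<open>d k = k powr (1/p) - (k-1) powr (1/p)\<close>, convexity of \<open>x powr p\<close> gives
  \<open>\<Sum> a k powr p \<le> (\<Sum> a k * d k) powr p\<close>, and summation by parts replaces \<open>d k\<close> by \<open>C / lam k\<close>.
  For necessity, take \<open>f (x, y) = (\<Sum>k. c k * indicator (A k) x)\<close> with \<open>A k\<close> consisting of odd
  multiples of \<open>1 / 2 ^ n k\<close>: between the first neighbouring points of the grid \<open>1 / 2 ^ n k\<close> the
  function jumps by at least \<open>c k\<close>, while each \<open>A k\<close> has few points per period and hence small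
  \<open>\<Lambda>\<close>-variation.\<close>

section \<open>Power sums of decreasing sequences against weighted sums\<close>

text \<open>Summation by parts with the remainders dropped: since the partial sums of
  \<open>w\<close> are nonnegative, replacing the factor \<open>a k\<close> in front of them by the
  smaller \<open>a (Suc k)\<close> only lowers the value. It is applied below to
  \<open>C * w i - d i\<close>, whose single terms may be negative.\<close>

lemma sum_mult_antimono_ge:
  fixes a w :: "nat \<Rightarrow> real"
  assumes anti: "\<And>i. 1 \<le> i \<Longrightarrow> i < m \<Longrightarrow> a (Suc i) \<le> a i"
    and nonneg: "\<And>k. 1 \<le> k \<Longrightarrow> k \<le> m \<Longrightarrow> 0 \<le> (\<Sum>i=1..k. w i)"
    and "1 \<le> k" "k \<le> m"
  shows "a k * (\<Sum>i=1..k. w i) \<le> (\<Sum>i=1..k. a i * w i)"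
  using assms(3,4)
proof (induction k rule: dec_induct)
  case base
  then show ?case by simp
next
  case (step k)
  have "a (Suc k) * (\<Sum>i=1..k. w i) \<le> a k * (\<Sum>i=1..k. w i)"
    using anti[of k] nonneg[of k] step by (intro mult_right_mono) auto
  then show ?case using step by (simp add: algebra_simps)
qed

text \<open>Both \<open>s + h\<close> and \<open>s'\<close> are convex combinations of the outer
  points \<open>s\<close> and \<open>s' + h\<close>, with complementary weights \<open>\<mu>\<close>
  and \<open>1 - \<mu>\<close>. Adding the two convexity inequalities makes the weights
  cancel.\<close>

lemma powr_increment_mono:
  fixes p :: real
  assumes "1 \<le> p" "0 < s" "s \<le> s'" "0 < h"
  shows "(s + h) powr p - s powr p \<le> (s' + h) powr p - s' powr p"
proof -
  define \<mu> where "\<mu> = h / (s' - s + h)"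
  have \<mu>: "0 \<le> \<mu>" "\<mu> \<le> 1" "\<mu> * (s' - s + h) = h"
    using assms by (auto simp: \<mu>_def)
  have cvx: "((1 - u) * s + u * (s' + h)) powr p \<le> (1 - u) * s powr p + u * (s' + h) powr p"
    if "0 \<le> u" "u \<le> 1" for u
    using convex_onD[OF powr_convex[OF assms(1)] that, of s "s' + h"] assms by simp
  have "(1 - \<mu>) * s + \<mu> * (s' + h) = s + h" "(1 - (1 - \<mu>)) * s + (1 - \<mu>) * (s' + h) = s'"
    using \<mu>(3) by (auto simp: algebra_simps)
  then show ?thesis
    using cvx[of \<mu>] cvx[of "1 - \<mu>"] \<mu> by (simp add: algebra_simps)
qed

lemma sum_powr_le_powr_sum:
  fixes a :: "nat \<Rightarrow> real" and p :: real
  assumes p: "1 \<le> p"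
    and nonneg: "\<And>i. 1 \<le> i \<Longrightarrow> i \<le> m \<Longrightarrow> 0 \<le> a i"
    and anti: "\<And>i. 1 \<le> i \<Longrightarrow> i < m \<Longrightarrow> a (Suc i) \<le> a i"
    and "1 \<le> k" "k \<le> m"
  shows "(\<Sum>i=1..k. a i powr p) \<le>
    (\<Sum>i=1..k. a i * (real i powr (1/p) - real (i - 1) powr (1/p))) powr p"
  using assms(4,5)
proof (induction k rule: dec_induct)
  case base
  then show ?case using p nonneg[of 1] by simp
next
  case (step k)
  define d where "d = (\<lambda>i. real i powr (1/p) - real (i - 1) powr (1/p))"
  define S where "S = (\<Sum>i=1..k. a i * d i)"
  have tel: "(\<Sum>i=1..j. d i) = real j powr (1/p)" for j
    by (induction j) (auto simp: d_def)
  show ?case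
  proof (cases "a (Suc k) = 0")
    case True
    then show ?thesis using step p by simp
  next
    case False
    then have pos: "0 < a (Suc k)" using nonneg[of "Suc k"] step by simp
    have "a k * (\<Sum>i=1..k. d i) \<le> S"
      unfolding S_def using anti step by (intro sum_mult_antimono_ge[of m]) (auto simp: tel simp del: One_nat_def)
    moreover have "a (Suc k) * real k powr (1/p) \<le> a k * real k powr (1/p)"
      using anti[of k] step by (intro mult_right_mono) auto
    ultimately have S: "a (Suc k) * real k powr (1/p) \<le> S" unfolding tel by linarith
    have "0 < d (Suc k)"
      using p by (simp add: d_def powr_less_mono2)
    \<comment> \<open>The increment starting at \<open>S\<close> is compared with the one of equal
      length starting at \<open>a (Suc k) * real k powr (1/p)\<close>. The latter is exactly
      \<open>a (Suc k) powr p * (Suc k - k)\<close>, which is the new term of the left-hand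
      sum.\<close>
    then have "(a (Suc k) * real k powr (1/p) + a (Suc k) * d (Suc k)) powr p
        - (a (Suc k) * real k powr (1/p)) powr p
      \<le> (S + a (Suc k) * d (Suc k)) powr p - S powr p"
      using p S pos step by (intro powr_increment_mono) auto
    also have "a (Suc k) * real k powr (1/p) + a (Suc k) * d (Suc k)
        = a (Suc k) * real (Suc k) powr (1/p)"
      by (simp add: d_def algebra_simps)
    finally have "a (Suc k) powr p \<le> (S + a (Suc k) * d (Suc k)) powr p - S powr p"
      using pos p by (simp add: powr_mult powr_powr algebra_simps)
    moreover have "(\<Sum>i=1..k. a i powr p) \<le> S powr p"
      using step by (simp add: S_def d_def)
    ultimately show ?thesis
      using step by (simp add: S_def d_def)
  qed
qed

lemma powr_norm_le_sum_weighted: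
  fixes a w :: "nat \<Rightarrow> real" and p C :: real
  assumes p: "1 \<le> p" and "1 \<le> m" "0 \<le> C"
    and nonneg: "\<And>i. 1 \<le> i \<Longrightarrow> i \<le> m \<Longrightarrow> 0 \<le> a i"
    and anti: "\<And>i. 1 \<le> i \<Longrightarrow> i < m \<Longrightarrow> a (Suc i) \<le> a i"
    and bound: "\<And>k. 1 \<le> k \<Longrightarrow> k \<le> m \<Longrightarrow> real k powr (1/p) \<le> C * (\<Sum>i=1..k. w i)"
  shows "(\<Sum>i=1..m. a i powr p) powr (1/p) \<le> C * (\<Sum>i=1..m. a i * w i)"
proof -
  define d where "d = (\<lambda>i. real i powr (1/p) - real (i - 1) powr (1/p))"
  have tel: "(\<Sum>i=1..j. d i) = real j powr (1/p)" for j
    by (induction j) (auto simp: d_def)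
  have d_nonneg: "0 \<le> d i" for i
    using p by (simp add: d_def powr_mono2)
  have "(\<Sum>i=1..m. a i powr p) powr (1/p) \<le> ((\<Sum>i=1..m. a i * d i) powr p) powr (1/p)"
    unfolding d_def using assms sum_powr_le_powr_sum[of p m a m]
    by (intro powr_mono2) (auto intro!: sum_nonneg)
  also have "\<dots> = (\<Sum>i=1..m. a i * d i)"
    using p nonneg d_nonneg sum_nonneg[of "{1..m}" "\<lambda>i. a i * d i"] by (simp add: powr_powr)
  also have "\<dots> \<le> C * (\<Sum>i=1..m. a i * w i)"
  proof -
    \<comment> \<open>Since \<open>d\<close> telescopes to \<open>real k powr (1/p)\<close>, the
      hypothesis \<open>bound\<close> says precisely that these partial sums are
      nonnegative.\<close>
    have partial: "0 \<le> (\<Sum>i=1..k. C * w i - d i)" if "1 \<le> k" "k \<le> m" for k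
      using bound[OF that] unfolding sum_subtractf tel by (simp flip: sum_distrib_left)
    have "0 \<le> a m * (\<Sum>i=1..m. C * w i - d i)"
      using partial[of m] nonneg[of m] \<open>1 \<le> m\<close> by simp
    also have "\<dots> \<le> (\<Sum>i=1..m. a i * (C * w i - d i))"
      using anti partial \<open>1 \<le> m\<close> by (intro sum_mult_antimono_ge[of m]) auto
    finally show ?thesis
      by (simp add: algebra_simps sum_subtractf sum_distrib_left)
  qed
  finally show ?thesis .
qed

lemma obtain_decreasing_enumeration:
  fixes b :: "'a \<Rightarrow> real"
  assumes "finite S"
  obtains \<sigma> where "bij_betw \<sigma> {1..card S} S"
    "\<And>i. 1 \<le> i \<Longrightarrow> i < card S \<Longrightarrow> b (\<sigma> (Suc i)) \<le> b (\<sigma> i)"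
proof -
  obtain ys where ys: "set ys = S" "distinct ys"
    using finite_distinct_list[OF assms] by auto
  define xs where "xs = sort_key (\<lambda>x. - b x) ys"
  have xs: "set xs = S" "distinct xs" "length xs = card S"
    using ys by (auto simp: xs_def distinct_card)
  have sorted: "sorted (map (\<lambda>x. - b x) xs)" by (simp add: xs_def)
  have "bij_betw ((!) xs) {..<card S} S"
    using xs by (intro bij_betw_nth) auto
  moreover have "bij_betw (\<lambda>i. i - 1) {1..card S} {..<card S}"
    by (rule bij_betw_byWitness[where f' = Suc]) auto
  ultimately have "bij_betw (\<lambda>i. xs ! (i - 1)) {1..card S} S"
    using bij_betw_trans by (fastforce simp: comp_def)
  moreover have "b (xs ! i) \<le> b (xs ! (i - 1))" if "1 \<le> i" "i < card S" for i
    using sorted_nth_mono[OF sorted, of "i - 1" i] that xs by simp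
  ultimately show thesis by (intro that) auto
qed

section \<open>Geometry of partitions with period 1\<close>

lemma period_partition_shift:
  assumes "(t, m) \<in> period_partitions"
  shows "t (k + c * int m) = t k + of_int c"
proof -
  have per: "t (j + int m) = t j + 1" for j
    using assms by (auto simp: period_partitions_def)
  show ?thesis
  proof (induction c rule: int_induct[where k = 0])
    case base
    then show ?case by simp
  next
    case (step1 c)
    then show ?case using per[of "k + c * int m"] by (simp add: algebra_simps)
  next
    case (step2 c)
    then show ?case using per[of "k + (c - 1) * int m"] by (simp add: algebra_simps)
  qed
qed

text \<open>Translating the interval with index \<open>j\<close> by \<open>c\<close> gives the one
  with index \<open>j + c * int m\<close> in the same partition. A point shared with interval
  \<open>i\<close> forces the indices to agree, and as \<open>i\<close> and \<open>j\<close> differ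
  by less than \<open>m\<close>, this leaves only \<open>c = 0\<close> and
  \<open>i = j\<close>.\<close>

lemma period_partition_shifts_disjoint:
  assumes t: "(t, m) \<in> period_partitions"
    and ij: "i \<in> {1..int m}" "j \<in> {1..int m}" "i \<noteq> j"
    and u: "u \<in> {t (i - 1)<..<t i}" and w: "w \<in> {t (j - 1)<..<t j}"
  shows "u \<noteq> w + of_int c"
proof
  assume eq: "u = w + of_int c"
  define l where "l = j + c * int m"
  have mono: "strict_mono t" using t by (auto simp: period_partitions_def)
  have "t l = t j + of_int c" "t (l - 1) = t (j - 1) + of_int c"
    using period_partition_shift[OF t, of j c] period_partition_shift[OF t, of "j - 1" c]
    by (simp_all add: l_def algebra_simps)
  then have *: "t (l - 1) < u" "u < t l" using w eq by auto
  have "t (l - 1) < t i" "t (i - 1) < t l" using * u by auto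
  then have "l - 1 < i" "i - 1 < l" using mono by (simp_all add: strict_mono_less)
  then have "i = j + c * int m" by (simp add: l_def)
  moreover have "\<bar>i - j\<bar> < int m" using ij by auto
  ultimately have "\<bar>c\<bar> * int m < 1 * int m" by (simp add: abs_mult)
  then have "c = 0" by (simp only: mult_less_cancel_right) auto
  with \<open>i = j + c * int m\<close> ij show False by simp
qed

text \<open>The gaps over one period add up to 1 and each is at least \<open>1 / 2 ^ n\<close>. This
  matches the range of \<open>m\<close> in the limsup condition.\<close>

lemma fine_partition_count:
  assumes "(t, m) \<in> fine_partitions n"
  shows "m \<le> 2 ^ n"
proof -
  have per: "(t, m) \<in> period_partitions"
    and inf: "(INF i\<in>{1..int m}. t i - t (i - 1)) \<ge> 1 / 2 ^ n"
    using assms by (auto simp: fine_partitions_def)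
  have gap: "1 / 2 ^ n \<le> t i - t (i - 1)" if "i \<in> {1..int m}" for i
    by (rule order_trans[OF inf], rule cINF_lower) (use that in auto)
  have "t 0 + real k / 2 ^ n \<le> t (int k)" if "k \<le> m" for k
    using that
  proof (induction k)
    case (Suc k)
    then show ?case using gap[of "int (Suc k)"] by (simp add: add_divide_distrib)
  qed simp
  from this[of m] have "real m / 2 ^ n \<le> 1"
    using period_partition_shift[OF per, of 0 1] by simp
  then have "real m \<le> real (2 ^ n)" by (simp add: field_simps)
  then show ?thesis by (simp only: of_nat_le_iff)
qed

section \<open>Sufficiency: bounding the \<open>p n\<close>-variation by the
  \<open>\<Lambda>\<close>-variation\<close>

lemma LambdaV1_finite_bound:
  assumes "LambdaV1 lam f < \<infinity>" and lam: "\<And>i. 1 \<le> i \<Longrightarrow> 0 < lam i"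
  obtains V where "0 \<le> V"
    "\<And>y m J. y \<in> UNIV \<rightarrow> {0..1} \<Longrightarrow> ({1..m}, J) \<in> interval_collections \<Longrightarrow>
      (\<Sum>i=1..m. \<bar>incr1 f (J i) (y i)\<bar> / lam i) \<le> V"
proof -
  obtain V where V: "LambdaV1 lam f = ennreal V" "0 \<le> V"
    using assms(1) by (cases "LambdaV1 lam f") auto
  have "(\<Sum>i=1..m. \<bar>incr1 f (J i) (y i)\<bar> / lam i) \<le> V"
    if y: "y \<in> UNIV \<rightarrow> {0..1}" and J: "({1..m}, J) \<in> interval_collections" for y m J
  proof -
    have "ennreal (\<Sum>i=1..m. \<bar>incr1 f (J i) (y i)\<bar> / lam i)
        = (\<Sum>\<^sub>\<infinity>i\<in>{1..m}. ennreal (\<bar>incr1 f (J i) (y i)\<bar> / lam i))"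
      using lam by (subst infsum_finite) (auto intro!: sum_ennreal[symmetric] divide_nonneg_pos simp del: One_nat_def)
    also have "\<dots> \<le> LambdaV1 lam f"
      unfolding LambdaV1_def
      by (rule SUP_upper2[OF y], rule SUP_upper2[OF J]) simp
    finally show ?thesis using V by simp
  qed
  with V(2) show thesis by (intro that)
qed

text \<open>An interval straddling an integer is cut there. Using either piece in its place gives two
  collections in \<open>[0,1]\<close>, hence the factor 2.\<close>

lemma period_partition_Lambda_sum_le:
  assumes per: "\<And>x y. f (x + 1, y) = f (x, y)"
    and lam: "\<And>i. 1 \<le> i \<Longrightarrow> 0 < lam i"
    and V: "\<And>y m J. y \<in> UNIV \<rightarrow> {0..1} \<Longrightarrow> ({1..m}, J) \<in> interval_collections \<Longrightarrow>
      (\<Sum>i=1..m. \<bar>incr1 f (J i) (y i)\<bar> / lam i) \<le> V"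
    and t: "(t, m) \<in> period_partitions"
    and y: "y \<in> UNIV \<rightarrow> {0..1}"
    and \<sigma>: "bij_betw \<sigma> {1..m} {1..int m}"
  shows "(\<Sum>k=1..m. \<bar>incr1 f (t (\<sigma> k - 1), t (\<sigma> k)) (y (\<sigma> k))\<bar> / lam k) \<le> 2 * V"
proof -
  have perc: "f (x + of_int c, y) = f (x, y)" for x y c
  proof (induction c rule: int_induct[where k = 0])
    case (step1 c)
    then show ?case using per[of "x + of_int c"] by (simp add: algebra_simps)
  next
    case (step2 c)
    then show ?case using per[of "x + of_int (c - 1)"] by (simp add: algebra_simps)
  qed simp
  have mono: "strict_mono t" and "0 < m" using t by (auto simp: period_partitions_def)
  \<comment> \<open>Translation by \<open>c i\<close> moves the left endpoint into
    \<open>[0,1)\<close>. An interval is at most one period long, so the right endpoint stays below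
    2 and 1 is the only possible cut. \<open>F\<close> keeps the piece left of the cut,
    \<open>G\<close> the piece right of it moved back by 1; without a cut both are the whole
    interval.\<close>
  define c where "c = (\<lambda>i. \<lfloor>t (i - 1)\<rfloor>)"
  define u where "u = (\<lambda>i. t (i - 1) - of_int (c i))"
  define v where "v = (\<lambda>i. t i - of_int (c i))"
  define F where "F = (\<lambda>i. (u i, min 1 (v i)))"
  define G where "G = (\<lambda>i. if v i \<le> 1 then (u i, v i) else (0, v i - 1))"
  have uv: "0 \<le> u i" "u i < 1" "u i < v i" "v i \<le> u i + 1" for i
  proof -
    show "0 \<le> u i" "u i < 1" by (auto simp: u_def c_def) linarith
    show "u i < v i" using mono by (simp add: u_def v_def strict_mono_less)
    have "t i \<le> t (i - 1 + 1 * int m)"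
      using \<open>0 < m\<close> mono by (simp add: strict_mono_less_eq)
    then show "v i \<le> u i + 1"
      unfolding period_partition_shift[OF t] by (simp add: u_def v_def)
  qed
  \<comment> \<open>Every interior point of \<open>K i\<close> is an integer translate of a point in
    the partition interval \<open>i\<close>, so an overlap would contradict disjointness modulo
    1.\<close>
  have coll: "({1..m}, K \<circ> \<sigma>) \<in> interval_collections"
    if K: "\<And>i. 0 \<le> fst (K i) \<and> fst (K i) < snd (K i) \<and> snd (K i) \<le> 1"
      and sub: "\<And>i x. fst (K i) < x \<Longrightarrow> x < snd (K i) \<Longrightarrow> \<exists>d::int. x + of_int d \<in> {t (i - 1)<..<t i}"
    for K
  proof -
    have "{fst (K (\<sigma> i))<..<snd (K (\<sigma> i))} \<inter> {fst (K (\<sigma> j))<..<snd (K (\<sigma> j))} = {}"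
      if ij: "i \<in> {1..m}" "j \<in> {1..m}" "i \<noteq> j" for i j
    proof (rule ccontr)
      assume "\<not> ?thesis"
      then obtain x where "x \<in> {fst (K (\<sigma> i))<..<snd (K (\<sigma> i))}"
        "x \<in> {fst (K (\<sigma> j))<..<snd (K (\<sigma> j))}" by blast
      then obtain d e :: int where
        "x + of_int d \<in> {t (\<sigma> i - 1)<..<t (\<sigma> i)}" "x + of_int e \<in> {t (\<sigma> j - 1)<..<t (\<sigma> j)}"
        using sub[of "\<sigma> i" x] sub[of "\<sigma> j" x] by auto
      moreover have "\<sigma> i \<in> {1..int m}" "\<sigma> j \<in> {1..int m}" "\<sigma> i \<noteq> \<sigma> j"
        using \<sigma> ij bij_betwE[OF \<sigma>] inj_onD[OF bij_betw_imp_inj_on[OF \<sigma>], of i j] by blast+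
      ultimately have "x + of_int d \<noteq> x + of_int e + of_int (d - e)"
        by (intro period_partition_shifts_disjoint[OF t]) auto
      then show False by simp
    qed
    then show ?thesis using K by (auto simp: interval_collections_def)
  qed
  have collF: "({1..m}, F \<circ> \<sigma>) \<in> interval_collections"
  proof (rule coll)
    fix i x assume "fst (F i) < x" "x < snd (F i)"
    then have "x + of_int (c i) \<in> {t (i - 1)<..<t i}" by (auto simp: F_def u_def v_def)
    then show "\<exists>d::int. x + of_int d \<in> {t (i - 1)<..<t i}" ..
  qed (use uv in \<open>auto simp: F_def\<close>)
  have collG: "({1..m}, G \<circ> \<sigma>) \<in> interval_collections"
  proof (rule coll)
    fix i x assume x: "fst (G i) < x" "x < snd (G i)"
    show "\<exists>d::int. x + of_int d \<in> {t (i - 1)<..<t i}"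
    proof (cases "v i \<le> 1")
      case True
      then have "x + of_int (c i) \<in> {t (i - 1)<..<t i}"
        using x by (auto simp: G_def u_def v_def)
      then show ?thesis ..
    next
      case False
      then have "x + of_int (c i + 1) \<in> {t (i - 1)<..<t i}"
        using x uv(2)[of i] by (auto simp: G_def u_def v_def)
      then show ?thesis ..
    qed
  next
    fix i show "0 \<le> fst (G i) \<and> fst (G i) < snd (G i) \<and> snd (G i) \<le> 1"
      using uv[of i] by (auto simp: G_def)
  qed
  \<comment> \<open>At a cut the values at 1 and 0 cancel by periodicity, so the increment is the
    sum of those over the two pieces.\<close>
  have split: "\<bar>incr1 f (t (i - 1), t i) z\<bar> \<le> \<bar>incr1 f (F i) z\<bar> + \<bar>incr1 f (G i) z\<bar>" for i z
  proof -
    have "f (t (i - 1), z) = f (u i, z)" "f (t i, z) = f (v i, z)"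
      using perc[of "u i" "c i"] perc[of "v i" "c i"] by (simp_all add: u_def v_def)
    moreover have "f (v i, z) = f (v i - 1, z)" "f (1, z) = f (0, z)"
      using per[of "v i - 1"] per[of 0] by simp_all
    ultimately show ?thesis by (auto simp: incr1_def F_def G_def min_def)
  qed
  have y\<sigma>: "(\<lambda>k. y (\<sigma> k)) \<in> UNIV \<rightarrow> {0..1}" using y by auto
  have "(\<Sum>k=1..m. \<bar>incr1 f (t (\<sigma> k - 1), t (\<sigma> k)) (y (\<sigma> k))\<bar> / lam k)
      \<le> (\<Sum>k=1..m. \<bar>incr1 f ((F \<circ> \<sigma>) k) (y (\<sigma> k))\<bar> / lam k
          + \<bar>incr1 f ((G \<circ> \<sigma>) k) (y (\<sigma> k))\<bar> / lam k)"
    using split lam by (intro sum_mono) (simp add: divide_right_mono less_imp_le flip: add_divide_distrib)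
  also have "\<dots> \<le> V + V"
    unfolding sum.distrib by (intro add_mono V[OF y\<sigma>] collF collG)
  finally show ?thesis by simp
qed

text \<open>\<open>LambdaV1\<close> admits every ordering of a collection and every choice of
  points. The increments over a partition can therefore be renumbered decreasingly, the points
  \<open>y i\<close> moving along, and the bound \<open>C * (2 * V)\<close> depends on neither
  \<open>y\<close>, \<open>n\<close> nor the partition.\<close>

lemma BVV1_finite_if_LambdaV1_finite:
  assumes per: "\<And>x y. f (x + 1, y) = f (x, y)"
    and lam: "\<And>i. 1 \<le> i \<Longrightarrow> 0 < lam i"
    and fin: "LambdaV1 lam f < \<infinity>"
    and p: "\<And>n. 1 \<le> n \<Longrightarrow> 1 \<le> p n"
    and "0 \<le> C"
    and C: "\<And>n k. 1 \<le> n \<Longrightarrow> 1 \<le> k \<Longrightarrow> k \<le> 2 ^ n \<Longrightarrow>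
      real k powr (1 / p n) \<le> C * (\<Sum>j=1..k. 1 / lam j)"
  shows "BVV1 p f < \<infinity>"
proof -
  obtain V where V: "0 \<le> V"
    "\<And>y m J. y \<in> UNIV \<rightarrow> {0..1} \<Longrightarrow> ({1..m}, J) \<in> interval_collections \<Longrightarrow>
      (\<Sum>i=1..m. \<bar>incr1 f (J i) (y i)\<bar> / lam i) \<le> V"
    using LambdaV1_finite_bound[OF fin lam] by blast
  have *: "(\<Sum>i=1..int m. \<bar>incr1 f (t (i - 1), t i) (y i)\<bar> powr p n) powr (1 / p n) \<le> C * (2 * V)"
    if y: "y \<in> UNIV \<rightarrow> {0..1}" and n: "1 \<le> n" and fine: "(t, m) \<in> fine_partitions n" for y n t m
  proof -
    define b where "b = (\<lambda>i. \<bar>incr1 f (t (i - 1), t i) (y i)\<bar>)"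
    have t: "(t, m) \<in> period_partitions" "1 \<le> m"
      using fine by (auto simp: fine_partitions_def period_partitions_def)
    obtain \<sigma> where \<sigma>: "bij_betw \<sigma> {1..m} {1..int m}"
      and dec: "\<And>i. 1 \<le> i \<Longrightarrow> i < m \<Longrightarrow> b (\<sigma> (Suc i)) \<le> b (\<sigma> i)"
      by (rule obtain_decreasing_enumeration[of "{1..int m}" b]) auto
    have "(\<Sum>i=1..int m. b i powr p n) powr (1 / p n) = (\<Sum>k=1..m. b (\<sigma> k) powr p n) powr (1 / p n)"
      using sum.reindex_bij_betw[OF \<sigma>, of "\<lambda>i. b i powr p n"] by simp
    also have "\<dots> \<le> C * (\<Sum>k=1..m. b (\<sigma> k) * (1 / lam k))"
      using p[OF n] t dec C[OF n] fine_partition_count[OF fine] \<open>0 \<le> C\<close>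
      by (intro powr_norm_le_sum_weighted) (auto simp: b_def simp del: One_nat_def)
    also have "\<dots> \<le> C * (2 * V)"
      using period_partition_Lambda_sum_le[where f = f and lam = lam and V = V, OF per lam V(2) t(1) y \<sigma>] \<open>0 \<le> C\<close>
      by (intro mult_left_mono) (auto simp: b_def)
    finally show ?thesis by (simp add: b_def)
  qed
  have "BVV1 p f \<le> ennreal (C * (2 * V))"
    unfolding BVV1_def by (intro SUP_least) (auto intro!: ennreal_leI * simp del: One_nat_def)
  also have "\<dots> < \<infinity>" by simp
  finally show ?thesis .
qed

text \<open>Together with its analogue for \<open>LambdaV2\<close>, this lets the first-variable
  result serve for both variables.\<close>

lemma BVV2_eq_BVV1_swap: "BVV2 p f = BVV1 p (f \<circ> prod.swap)"
  by (simp add: BVV1_def BVV2_def incr1_def incr2_def)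

lemma LambdaV2_eq_LambdaV1_swap: "LambdaV2 lam f = LambdaV1 lam (f \<circ> prod.swap)"
  by (simp add: LambdaV1_def LambdaV2_def incr1_def incr2_def)

section \<open>Extremal weights and endpoints of nonoverlapping intervals\<close>

text \<open>The smallest indices carry the largest weights. If \<open>F\<close> has
  \<open>Suc m\<close> elements, its maximum is at least \<open>Suc m\<close>, so its weight is at
  most \<open>1 / lam (Suc m)\<close>; the rest follows by induction.\<close>

lemma sum_inverse_le_initial_segment:
  fixes lam :: "nat \<Rightarrow> real"
  assumes lam: "\<And>i. 1 \<le> i \<Longrightarrow> 0 < lam i" and mono: "mono_on {1..} lam"
    and "finite F" "F \<subseteq> {1..}" "card F \<le> m"
  shows "(\<Sum>i\<in>F. 1 / lam i) \<le> (\<Sum>j=1..m. 1 / lam j)"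
  using assms(3-5)
proof (induction m arbitrary: F)
  case 0
  then show ?case by simp
next
  case (Suc m)
  show ?case
  proof (cases "card F \<le> m")
    case True
    then have "(\<Sum>i\<in>F. 1 / lam i) \<le> (\<Sum>j=1..m. 1 / lam j)"
      using Suc.prems by (intro Suc.IH)
    then show ?thesis using lam[of "Suc m"] by (simp add: add_increasing2)
  next
    case False
    then have card: "card F = Suc m" and ne: "F \<noteq> {}" using Suc.prems by auto
    define M where "M = Max F"
    have M: "M \<in> F" using ne Suc.prems by (simp add: M_def)
    have "F \<subseteq> {1..M}" using Suc.prems by (auto simp: M_def)
    then have "Suc m \<le> M" using card_mono[of "{1..M}" F] card by simp
    then have "lam (Suc m) \<le> lam M" using mono by (auto simp: mono_on_def)
    then have "1 / lam M \<le> 1 / lam (Suc m)" using lam[of "Suc m"] by (simp add: frac_le)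
    moreover have "(\<Sum>i\<in>F - {M}. 1 / lam i) \<le> (\<Sum>j=1..m. 1 / lam j)"
      using Suc.prems card M by (intro Suc.IH) auto
    moreover have "(\<Sum>i\<in>F. 1 / lam i) = 1 / lam M + (\<Sum>i\<in>F - {M}. 1 / lam i)"
      using M Suc.prems by (intro sum.remove)
    ultimately show ?thesis by simp
  qed
qed

text \<open>Two intervals with a common left endpoint overlap just to its right, and similarly for
  right endpoints. Hence a set of \<open>m\<close> points contains at most \<open>m\<close> left and
  at most \<open>m\<close> right endpoints.\<close>

lemma interval_collection_inj_endpoints:
  assumes "(N, J) \<in> interval_collections"
  shows "inj_on (\<lambda>i. fst (J i)) N" "inj_on (\<lambda>i. snd (J i)) N"
proof -
  have lt: "fst (J i) < snd (J i)" if "i \<in> N" for i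
    using assms that by (auto simp: interval_collections_def)
  have disj: "{fst (J i)<..<snd (J i)} \<inter> {fst (J j)<..<snd (J j)} = {}"
    if "i \<in> N" "j \<in> N" "i \<noteq> j" for i j
    using assms that by (simp add: interval_collections_def)
  show "inj_on (\<lambda>i. fst (J i)) N"
  proof (rule inj_onI, rule ccontr)
    fix i j assume ij: "i \<in> N" "j \<in> N" "fst (J i) = fst (J j)" "i \<noteq> j"
    then obtain x where "fst (J i) < x" "x < min (snd (J i)) (snd (J j))"
      using lt dense[of "fst (J i)" "min (snd (J i)) (snd (J j))"] by fastforce
    then have "x \<in> {fst (J i)<..<snd (J i)} \<inter> {fst (J j)<..<snd (J j)}" using ij by simp
    then show False using disj ij by blast
  qed
  show "inj_on (\<lambda>i. snd (J i)) N"
  proof (rule inj_onI, rule ccontr)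
    fix i j assume ij: "i \<in> N" "j \<in> N" "snd (J i) = snd (J j)" "i \<noteq> j"
    then obtain x where "x < snd (J i)" "max (fst (J i)) (fst (J j)) < x"
      using lt dense[of "max (fst (J i)) (fst (J j))" "snd (J i)"] by fastforce
    then have "x \<in> {fst (J i)<..<snd (J i)} \<inter> {fst (J j)<..<snd (J j)}" using ij by simp
    then show False using disj ij by blast
  qed
qed

section \<open>Periodic sets of dyadic points with odd numerator\<close>

text \<open>Oddness of \<open>s\<close> puts the fraction in lowest terms, so sets with different
  \<open>n\<close> are disjoint. Bounding the residue rather than \<open>s\<close> makes the set
  1-periodic when \<open>n \<ge> 1\<close>.\<close>

definition odd_dyadics :: "nat \<Rightarrow> nat \<Rightarrow> real set" where
  "odd_dyadics n m = {of_int s / 2 ^ n |s :: int. odd s \<and> s mod 2 ^ n \<le> int m}"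

lemma countable_odd_dyadics: "countable (odd_dyadics n m)"
  by (rule countable_subset[of _ "range (\<lambda>s::int. of_int s / 2 ^ n)"]) (auto simp: odd_dyadics_def)

lemma odd_dyadics_grid:
  "of_int i / 2 ^ n \<in> odd_dyadics n m \<longleftrightarrow> odd i \<and> i mod 2 ^ n \<le> int m"
  by (auto simp: odd_dyadics_def)

lemma odd_dyadics_periodic:
  assumes "1 \<le> n"
  shows "x + 1 \<in> odd_dyadics n m \<longleftrightarrow> x \<in> odd_dyadics n m"
proof
  assume "x + 1 \<in> odd_dyadics n m"
  then obtain s :: int where s: "x + 1 = of_int s / 2 ^ n" "odd s" "s mod 2 ^ n \<le> int m"
    by (auto simp: odd_dyadics_def)
  have "x = of_int (s - 2 ^ n) / 2 ^ n" using s(1) by (simp add: field_simps)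
  moreover have "odd (s - 2 ^ n)" "(s - 2 ^ n) mod 2 ^ n \<le> int m" using s assms by auto
  ultimately show "x \<in> odd_dyadics n m" unfolding odd_dyadics_def by blast
next
  assume "x \<in> odd_dyadics n m"
  then obtain s :: int where s: "x = of_int s / 2 ^ n" "odd s" "s mod 2 ^ n \<le> int m"
    by (auto simp: odd_dyadics_def)
  have "x + 1 = of_int (s + 2 ^ n) / 2 ^ n" using s(1) by (simp add: field_simps)
  moreover have "odd (s + 2 ^ n)" "(s + 2 ^ n) mod 2 ^ n \<le> int m" using s assms by auto
  ultimately show "x + 1 \<in> odd_dyadics n m" unfolding odd_dyadics_def by blast
qed

text \<open>The points 0 and 1 drop out because their numerators \<open>0\<close> and
  \<open>2 ^ n\<close> are even; any other numerator in range is its own residue.\<close>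

lemma odd_dyadics_unit_interval:
  assumes "1 \<le> n"
  shows "odd_dyadics n m \<inter> {0..1} \<subseteq> (\<lambda>r. real r / 2 ^ n) ` {1..m}"
proof
  fix x assume "x \<in> odd_dyadics n m \<inter> {0..1}"
  then obtain s :: int where s: "x = of_int s / 2 ^ n" "odd s" "s mod 2 ^ n \<le> int m"
    and x: "0 \<le> x" "x \<le> 1"
    by (auto simp: odd_dyadics_def)
  have "0 \<le> real_of_int s" using mult_nonneg_nonneg[OF x(1), of "2 ^ n"] s(1) by simp
  then have "0 \<le> s" by simp
  have "real_of_int s \<le> real_of_int (2 ^ n)" using x s by (simp add: divide_le_eq)
  then have "s \<le> 2 ^ n" by (simp only: of_int_le_iff)
  moreover have "s \<noteq> 2 ^ n" "s \<noteq> 0" using s(2) assms by auto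
  ultimately have "s mod 2 ^ n = s" "1 \<le> s" using \<open>0 \<le> s\<close> by auto
  then show "x \<in> (\<lambda>r. real r / 2 ^ n) ` {1..m}"
    using s by (intro image_eqI[of _ _ "nat s"]) auto
qed

lemma card_odd_dyadics_preimage_le:
  assumes "1 \<le> n" "inj_on e F" "e ` F \<subseteq> {0..1}"
  shows "card {i \<in> F. e i \<in> odd_dyadics n m} \<le> m"
proof -
  have "card {i \<in> F. e i \<in> odd_dyadics n m} \<le> card ((\<lambda>r. real r / 2 ^ n) ` {1..m})"
    using assms odd_dyadics_unit_interval[OF assms(1), of m]
    by (intro card_inj_on_le[where f = e]) (auto intro: inj_on_subset)
  also have "\<dots> \<le> m" using card_image_le[of "{1..m}" "\<lambda>r. real r / 2 ^ n"] by simp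
  finally show ?thesis .
qed

text \<open>A fraction in lowest terms with denominator \<open>2 ^ n'\<close> lies on the grid
  \<open>1 / 2 ^ n\<close> only for \<open>n' \<le> n\<close>, and on a strictly finer grid its
  numerator gains a factor 2.\<close>

lemma odd_dyadics_other_grid:
  assumes "of_int i / 2 ^ n \<in> odd_dyadics n' m'" "n \<noteq> n'"
  shows "n' < n \<and> even i"
proof -
  obtain s :: int where s: "of_int i / 2 ^ n = (of_int s / 2 ^ n' :: real)" "odd s"
    using assms by (auto simp: odd_dyadics_def)
  have "real_of_int (i * 2 ^ n') = real_of_int (s * 2 ^ n)"
    using s(1) by (simp add: field_simps)
  then have eq: "i * 2 ^ n' = s * 2 ^ n" by (simp only: of_int_eq_iff)
  show ?thesis
  proof (cases "n' < n")
    case True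
    have "(2 :: int) ^ n = 2 ^ (n - n') * 2 ^ n'"
      using True by (simp flip: power_add)
    with eq have "i * 2 ^ n' = (s * 2 ^ (n - n')) * 2 ^ n'"
      by (simp only: mult.assoc)
    then have "i = s * 2 ^ (n - n')" by simp
    then show ?thesis using True by simp
  next
    case False
    have "(2 :: int) ^ n' = 2 ^ (n' - n) * 2 ^ n"
      using False by (simp flip: power_add)
    with eq have "s * 2 ^ n = (i * 2 ^ (n' - n)) * 2 ^ n"
      by (simp only: mult.assoc)
    then have "s = i * 2 ^ (n' - n)" by simp
    then show ?thesis using s False assms(2) by simp
  qed
qed

lemma dyadic_fine_partition:
  "((\<lambda>i. of_int i / 2 ^ n), 2 ^ n) \<in> fine_partitions n"
proof -
  have "((\<lambda>i. of_int i / 2 ^ n), 2 ^ n) \<in> period_partitions"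
    by (auto simp: period_partitions_def strict_mono_def divide_strict_right_mono add_divide_distrib)
  moreover have "1 / 2 ^ n \<le> (INF i\<in>{1..int (2 ^ n)}. of_int i / 2 ^ n - of_int (i - 1) / 2 ^ n :: real)"
    by (intro cINF_greatest) (auto simp: diff_divide_distrib)
  ultimately show ?thesis by (simp add: fine_partitions_def)
qed

text \<open>For nonnegative \<open>g\<close> an increment is at most the sum of the two endpoint
  values. Left endpoints are distinct, and so are right endpoints, so each family contributes at
  most \<open>B\<close>. Infinite collections reduce to their finite subfamilies.\<close>

lemma LambdaV1_le_of_positive_part:
  fixes g :: "real \<Rightarrow> real"
  assumes lam: "\<And>i. 1 \<le> i \<Longrightarrow> 0 < lam i"
    and g: "\<And>x. 0 \<le> g x"
    and B: "\<And>F e. finite F \<Longrightarrow> F \<subseteq> {1..} \<Longrightarrow> inj_on e F \<Longrightarrow> e ` F \<subseteq> {0..1} \<Longrightarrow>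
      (\<Sum>i\<in>F. g (e i) / lam i) \<le> B"
  shows "LambdaV1 lam (\<lambda>z. g (fst z)) \<le> ennreal (2 * B)"
  unfolding LambdaV1_def
proof (intro SUP_least, clarify)
  fix y :: "nat \<Rightarrow> real" and N :: "nat set" and J
  assume coll: "(N, J) \<in> interval_collections"
  define a b where "a = (\<lambda>i. fst (J i))" and "b = (\<lambda>i. snd (J i))"
  have N: "N \<subseteq> {1..}" using coll by (auto simp: interval_collections_def)
  have "0 \<le> a i \<and> a i < b i \<and> b i \<le> 1" if "i \<in> N" for i
    using coll that by (auto simp: interval_collections_def a_def b_def)
  then have ab: "a ` N \<subseteq> {0..1}" "b ` N \<subseteq> {0..1}" by fastforce+
  have inj: "inj_on a N" "inj_on b N"
    using interval_collection_inj_endpoints[OF coll] by (simp_all add: a_def b_def)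
  show "(\<Sum>\<^sub>\<infinity>i\<in>N. ennreal (\<bar>incr1 (\<lambda>z. g (fst z)) (J i) (y i)\<bar> / lam i)) \<le> ennreal (2 * B)"
  proof (rule infsum_le_finite_sums)
    fix F assume F: "finite F" "F \<subseteq> N"
    have pos: "0 < lam i" if "i \<in> F" for i using lam that F N by auto
    have "(\<Sum>i\<in>F. ennreal (\<bar>incr1 (\<lambda>z. g (fst z)) (J i) (y i)\<bar> / lam i))
        = ennreal (\<Sum>i\<in>F. \<bar>g (b i) - g (a i)\<bar> / lam i)"
      using pos by (simp add: sum_ennreal less_imp_le incr1_def a_def b_def)
    also have "(\<Sum>i\<in>F. \<bar>g (b i) - g (a i)\<bar> / lam i) \<le> (\<Sum>i\<in>F. g (a i) / lam i + g (b i) / lam i)"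
    proof (rule sum_mono)
      fix i assume "i \<in> F"
      have "\<bar>g (b i) - g (a i)\<bar> \<le> g (a i) + g (b i)" using g[of "a i"] g[of "b i"] by linarith
      then show "\<bar>g (b i) - g (a i)\<bar> / lam i \<le> g (a i) / lam i + g (b i) / lam i"
        using pos[OF \<open>i \<in> F\<close>] by (simp add: divide_right_mono flip: add_divide_distrib)
    qed
    also have "\<dots> \<le> B + B"
      unfolding sum.distrib using F N ab inj
      by (intro add_mono B) (blast intro: inj_on_subset)+
    finally show "(\<Sum>i\<in>F. ennreal (\<bar>incr1 (\<lambda>z. g (fst z)) (J i) (y i)\<bar> / lam i)) \<le> ennreal (2 * B)"
      by (simp add: ennreal_leI)
  qed (rule nonneg_summable_on_complete, simp)
qed

section \<open>Necessity: a function in \<open>LambdaBV\<close> outside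
  \<open>BVsharp\<close>\<close>

text \<open>The thresholds in \<open>unbounded\<close> serve the recursive choice of generations:
  strictly increasing \<open>n k\<close> keeps the sets \<open>A k\<close> disjoint, and
  nondecreasing \<open>m k\<close> makes the heights \<open>c k\<close> at least halve at each
  step.\<close>

lemma LambdaBV_not_subset_BVsharp:
  fixes lam p :: "nat \<Rightarrow> real"
  assumes lam: "\<And>i. 1 \<le> i \<Longrightarrow> 0 < lam i" and mono: "mono_on {1..} lam"
    and p: "\<And>n. 1 \<le> n \<Longrightarrow> 1 \<le> p n"
    and unbounded: "\<And>B N M. \<exists>n m. N \<le> n \<and> M < m \<and> m \<le> 2 ^ n \<and>
      B < real m powr (1 / p n) / (\<Sum>j=1..m. 1 / lam j)"
  shows "\<not> LambdaBV lam \<subseteq> BVsharp p"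
proof -
  define L where "L = (\<lambda>m. \<Sum>j=1..m. 1 / lam j)"
  have L_mono: "L m \<le> L m'" if "m \<le> m'" for m m'
    unfolding L_def using that by (intro sum_mono2) (auto simp: lam less_imp_le)
  have L_pos: "0 < L m" if "1 \<le> m" for m
    unfolding L_def using lam that by (intro sum_pos) auto
  define P where "P = (\<lambda>k (n, m). 1 \<le> n \<and> 1 \<le> m \<and> m \<le> 2 ^ n \<and>
    4 ^ k < real m powr (1 / p n) / L m)"
  have "\<exists>q. \<forall>k. P k (q k) \<and> fst (q k) < fst (q (Suc k)) \<and> snd (q k) \<le> snd (q (Suc k))"
  proof (rule dependent_nat_choice)
    obtain n m where "1 \<le> n" "0 < m" "m \<le> 2 ^ n" "1 < real m powr (1 / p n) / L m"
      using unbounded[of 1 0 1] unfolding L_def by blast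
    then have "P 0 (n, m)" by (simp add: P_def)
    then show "\<exists>x. P 0 x" ..
  next
    fix x k assume "P k x"
    obtain n m where "Suc (fst x) \<le> n" "snd x < m" "m \<le> 2 ^ n"
      "4 ^ Suc k < real m powr (1 / p n) / L m"
      using unbounded[of "Suc (fst x)" "snd x" "4 ^ Suc k"] unfolding L_def by blast
    then have "P (Suc k) (n, m) \<and> fst x < fst (n, m) \<and> snd x \<le> snd (n, m)"
      by (simp add: P_def)
    then show "\<exists>y. P (Suc k) y \<and> fst x < fst y \<and> snd x \<le> snd y" ..
  qed
  then obtain q where q: "\<And>k. P k (q k)" "\<And>k. fst (q k) < fst (q (Suc k))"
    "\<And>k. snd (q k) \<le> snd (q (Suc k))" by blast
  define n m where "n = (\<lambda>k. fst (q k))" and "m = (\<lambda>k. snd (q k))"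
  have nm: "1 \<le> n k" "1 \<le> m k" "m k \<le> 2 ^ n k" "4 ^ k < real (m k) powr (1 / p (n k)) / L (m k)" for k
    using q(1)[of k] by (auto simp: P_def n_def m_def split: prod.splits)
  have n_mono: "strict_mono n" using q(2) by (simp add: n_def strict_mono_Suc_iff)
  define A where "A = (\<lambda>k. odd_dyadics (n k) (m k))"
  \<comment> \<open>The height balances two demands: \<open>c k * L (m k) = (1/2) ^ k\<close> is
    summable, while the factor \<open>4 ^ k\<close> in \<open>P\<close> still leaves a
    \<open>p (n k)\<close>-variation of at least \<open>2 ^ k\<close>.\<close>
  define c where "c = (\<lambda>k. (1/2) ^ k / L (m k))"
  define g where "g = (\<lambda>x. \<Sum>k. c k * indicator (A k) x :: real)"
  define f where "f = (\<lambda>z::real \<times> real. g (fst z))"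
  have c_pos: "0 < c k" for k using L_pos[OF nm(2)] by (simp add: c_def)
  have c_Suc: "2 * c (Suc k) \<le> c k" for k
    using L_mono[OF q(3)[of k]] L_pos[OF nm(2)[of k]]
    by (auto simp: c_def m_def intro!: divide_left_mono mult_pos_pos)
  have "decseq c" using c_Suc c_pos by (intro decseq_SucI) (smt (verit))
  have c_less: "2 * c k \<le> c j" if "j < k" for j k
    using c_Suc[of j] decseqD[OF \<open>decseq c\<close>, of "Suc j" k] that by auto
  have "summable c"
  proof (rule summable_comparison_test')
    show "summable (\<lambda>k. (1/2) ^ k / L 1 :: real)"
      by (intro summable_divide summable_geometric) simp
    show "norm (c k) \<le> (1/2) ^ k / L 1" for k
      using L_mono[OF nm(2)[of k]] L_pos[of 1] L_pos[OF nm(2)[of k]]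
      by (auto simp: c_def intro!: divide_left_mono mult_pos_pos)
  qed
  then have summable: "summable (\<lambda>k. c k * indicator (A k) x :: real)" for x
    by (rule summable_comparison_test'[where N = 0]) (use c_pos in \<open>auto simp: indicator_def less_imp_le\<close>)
  have g_nonneg: "0 \<le> g x" for x
    unfolding g_def using c_pos by (intro suminf_nonneg summable) (simp add: less_imp_le)
  have c_le_g: "c k \<le> g x" if "x \<in> A k" for k x
    using sum_le_suminf[OF summable[of x], of "{k}"] c_pos that
    by (simp add: g_def less_imp_le)

  \<comment> \<open>At most \<open>m k\<close> of the distinct points \<open>e i\<close> hit
    \<open>A k\<close>, and their weights add up to at most \<open>L (m k)\<close>. Generation
    \<open>k\<close> thus contributes at most \<open>(1/2) ^ k\<close>.\<close>
  have Lambda: "(\<Sum>i\<in>F. g (e i) / lam i) \<le> 2"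
    if F: "finite F" "F \<subseteq> {1..}" "inj_on e F" "e ` F \<subseteq> {0..1}" for F :: "nat set" and e
  proof -
    have "(\<Sum>i\<in>F. g (e i) / lam i) = (\<Sum>i\<in>F. \<Sum>k. c k * indicator (A k) (e i) / lam i)"
      unfolding g_def by (intro sum.cong suminf_divide[symmetric] summable refl)
    also have "\<dots> = (\<Sum>k. \<Sum>i\<in>F. c k * indicator (A k) (e i) / lam i)"
      by (intro suminf_sum[symmetric] summable_divide summable)
    also have "\<dots> \<le> (\<Sum>k. (1/2) ^ k)"
    proof (intro suminf_le summable_sum summable_divide summable summable_geometric)
      fix k
      have "(\<Sum>i\<in>F. c k * indicator (A k) (e i) / lam i) = c k * (\<Sum>i | i \<in> F \<and> e i \<in> A k. 1 / lam i)"
        using F(1) by (auto simp: sum_distrib_left indicator_def intro!: sum.mono_neutral_cong_right)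
      also have "\<dots> \<le> c k * L (m k)"
        unfolding L_def using F c_pos[of k] card_odd_dyadics_preimage_le[OF nm(1)[of k] F(3,4)]
        by (intro mult_left_mono sum_inverse_le_initial_segment lam mono) (auto simp: A_def)
      also have "\<dots> = (1/2) ^ k" using L_pos[OF nm(2)[of k]] by (simp add: c_def)
      finally show "(\<Sum>i\<in>F. c k * indicator (A k) (e i) / lam i) \<le> (1/2) ^ k" .
    qed simp
    also have "\<dots> = (2 :: real)" by (simp add: suminf_geometric)
    finally show ?thesis .
  qed
  have "LambdaV1 lam f \<le> ennreal (2 * 2)"
    unfolding f_def by (intro LambdaV1_le_of_positive_part lam g_nonneg Lambda)
  moreover have "LambdaV2 lam f \<le> 0"
    unfolding LambdaV2_def by (intro SUP_least, clarify) (simp add: incr2_def f_def)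
  moreover have "f \<in> periodic_measurable"
  proof -
    have "A k \<in> sets borel" for k
      unfolding A_def by (rule sets.countable) (auto intro: countable_odd_dyadics)
    then have "g \<in> borel_measurable borel"
      unfolding g_def by (intro borel_measurable_suminf borel_measurable_times) auto
    then have "f \<in> borel_measurable borel"
      unfolding f_def by (rule measurable_compose[rotated]) (intro borel_measurable_continuous_onI continuous_intros)
    then have "f \<in> borel_measurable lebesgue" by (intro measurable_completion) simp
    moreover have "g (x + 1) = g x" for x
      using odd_dyadics_periodic[OF nm(1)] by (simp add: g_def A_def indicator_def)
    ultimately show ?thesis by (simp add: periodic_measurable_def f_def)
  qed
  ultimately have "f \<in> LambdaBV lam"
    using le_less_trans[of "LambdaV1 lam f" "ennreal (2 * 2)" \<infinity>] by (simp add: LambdaBV_def)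

  text \<open>A coarser generation contributes either 0 or at least \<open>2 * c k\<close> at an even grid point, so it
    cannot cancel the jump \<open>c k\<close>.\<close>

  have grid: "c k \<le> \<bar>g (of_int i / 2 ^ n k) - g (of_int j / 2 ^ n k)\<bar>"
    if "odd i" "1 \<le> i" "i \<le> int (m k)" "even j" for i j k
  proof -
    \<comment> \<open>Since \<open>m k\<close> may equal \<open>2 ^ n k\<close>, it is parity that
      keeps \<open>i\<close> strictly below the modulus.\<close>
    have "i \<noteq> 2 ^ n k" using that nm(1)[of k] by auto
    moreover have "int (m k) \<le> 2 ^ n k"
      using nm(3)[of k] by (metis of_nat_le_iff of_nat_numeral of_nat_power)
    ultimately have "i < 2 ^ n k" using that(3) by linarith
    then have i_mod: "i mod 2 ^ n k = i" using that by simp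
    \<comment> \<open>A point of another generation on this grid would have an even numerator, so
      \<open>g\<close> takes the exact value \<open>c k\<close> here.\<close>
    have "(of_int i / 2 ^ n k :: real) \<in> A l \<longleftrightarrow> l = k" for l
      using that i_mod odd_dyadics_other_grid[of i "n k" "n l" "m l"] strict_mono_eq[OF n_mono, of l k]
      by (auto simp: A_def odd_dyadics_grid)
    then have "g (of_int i / 2 ^ n k) = (\<Sum>l. if l = k then c l else 0)"
      unfolding g_def by (intro arg_cong[where f = suminf] ext) (simp add: indicator_def)
    then have gi: "g (of_int i / 2 ^ n k) = c k"
      using sums_unique[OF sums_single[of k c]] by simp
    show ?thesis
    proof (cases "\<exists>l. (of_int j / 2 ^ n k :: real) \<in> A l")
      case True
      then obtain l where l: "(of_int j / 2 ^ n k :: real) \<in> A l" by blast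
      then have "n k \<noteq> n l" using that odd_dyadics_grid[of j "n k" "m l"] by (auto simp: A_def)
      then have "l < k"
        using l odd_dyadics_other_grid[of j "n k" "n l" "m l"] strict_mono_less[OF n_mono] by (auto simp: A_def)
      then show ?thesis using c_less[of l k] c_le_g[OF l] gi c_pos[of k] by linarith
    next
      case False
      then have "g (of_int j / 2 ^ n k) = 0" by (simp add: g_def)
      then show ?thesis using gi c_pos[of k] by simp
    qed
  qed
  have "ennreal (2 ^ k) \<le> BVV1 p f" for k
  proof -
    define t where "t = (\<lambda>i. of_int i / 2 ^ n k :: real)"
    \<comment> \<open>Exactly one of \<open>i - 1\<close> and \<open>i\<close> is odd, and that one
      lies between 1 and \<open>m k\<close>, so \<open>grid\<close> applies in both cases.\<close>
    have jump: "c k \<le> \<bar>incr1 f (t (i - 1), t i) 0\<bar>" if "i \<in> {1..int (m k)}" for i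
    proof (cases "odd i")
      case True
      then show ?thesis using that grid[of i k "i - 1"] by (simp add: incr1_def f_def t_def)
    next
      case False
      then have "2 \<le> i" using that by (cases "i = 1") auto
      then show ?thesis using that False grid[of "i - 1" k i]
        by (simp add: incr1_def f_def t_def abs_minus_commute)
    qed
    have pk: "1 \<le> p (n k)" using p nm by blast
    have "(2 :: real) ^ k = (1/2) ^ k * 4 ^ k" by (simp flip: power_mult_distrib)
    also have "\<dots> \<le> (1/2) ^ k * (real (m k) powr (1 / p (n k)) / L (m k))"
      using nm(4)[of k] by (intro mult_left_mono) auto
    also have "\<dots> = (real (m k) * c k powr p (n k)) powr (1 / p (n k))"
      using c_pos[of k] pk L_pos[OF nm(2)[of k]] by (simp add: powr_mult powr_powr c_def)
    also have "real (m k) * c k powr p (n k) = (\<Sum>i=1..int (m k). c k powr p (n k))" by simp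
    also have "(\<dots>) powr (1 / p (n k)) \<le>
        (\<Sum>i=1..int (2 ^ n k). \<bar>incr1 f (t (i - 1), t i) 0\<bar> powr p (n k)) powr (1 / p (n k))"
    proof (rule powr_mono2)
      have "(\<Sum>i=1..int (m k). c k powr p (n k))
          \<le> (\<Sum>i=1..int (m k). \<bar>incr1 f (t (i - 1), t i) 0\<bar> powr p (n k))"
        using jump pk c_pos[of k] by (intro sum_mono powr_mono2) auto
      also have "\<dots> \<le> (\<Sum>i=1..int (2 ^ n k). \<bar>incr1 f (t (i - 1), t i) 0\<bar> powr p (n k))"
        using of_nat_mono[OF nm(3)[of k], where 'a = int] by (intro sum_mono2) auto
      finally show "(\<Sum>i=1..int (m k). c k powr p (n k)) \<le> \<dots>" .
    qed (use pk in \<open>auto intro!: sum_nonneg\<close>)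
    finally have "ennreal (2 ^ k) \<le> ennreal \<dots>" by (rule ennreal_leI)
    also have "\<dots> \<le> BVV1 p f"
      unfolding BVV1_def
      by (rule SUP_upper2[of "\<lambda>_. 0"], simp, rule SUP_upper2[of "n k"], use nm in simp,
          rule SUP_upper2[OF dyadic_fine_partition[of "n k"]]) (simp add: t_def)
    finally show ?thesis .
  qed
  moreover have "\<exists>k. r < 2 ^ k" for r :: real using real_arch_pow[of 2 r] by simp
  ultimately have "BVV1 p f \<noteq> ennreal r" if "0 \<le> r" for r
    using that by (metis ennreal_le_iff not_le)
  then have "\<not> BVV1 p f < \<infinity>"
    by (cases "BVV1 p f") auto
  then have "f \<notin> BVsharp p" by (simp add: BVsharp_def)
  with \<open>f \<in> LambdaBV lam\<close> show ?thesis by blast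
qed

section \<open>From the limsup condition to uniform bounds and back\<close>

theorem theorem3:
  fixes lam p :: "nat \<Rightarrow> real"
  assumes "1 < lam 1"
    and "mono_on {1..} lam"
    and "filterlim lam at_top sequentially"
    and "filterlim (\<lambda>n. \<Sum>j=1..n. 1 / lam j) at_top sequentially"
    and "mono_on {1..} p"
    and "\<forall>n\<ge>1. 1 \<le> p n"
    and "filterlim p at_top sequentially"
  shows "LambdaBV lam \<subseteq> BVsharp p \<longleftrightarrow>
    limsup (\<lambda>n. SUP m\<in>{1..2 ^ n}. ereal (real m powr (1 / p n) / (\<Sum>j=1..m. 1 / lam j))) < \<infinity>"
proof -
  have lam: "0 < lam i" if "1 \<le> i" for i
    using mono_onD[OF assms(2), of 1 i] assms(1) that by simp
  have p: "1 \<le> p n" if "1 \<le> n" for n using assms(6) that by blast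
  define L where "L = (\<lambda>m. \<Sum>j=1..m. 1 / lam j)"
  define R where "R = (\<lambda>n m. real m powr (1 / p n) / L m)"
  have L_pos: "0 < L m" if "1 \<le> m" for m
    unfolding L_def using lam that by (intro sum_pos) auto
  have R_nonneg: "0 \<le> R n m" if "1 \<le> m" for n m
    using L_pos[OF that] by (simp add: R_def)
  let ?X = "\<lambda>n. SUP m\<in>{1..2 ^ n}. ereal (R n m)"
  have "LambdaBV lam \<subseteq> BVsharp p \<longleftrightarrow> limsup ?X < \<infinity>"
  proof
    assume lim: "limsup ?X < \<infinity>"
    then obtain B where "limsup ?X < ereal B"
      using less_PInf_Ex_of_nat by auto
    then obtain N where N: "\<And>n. N \<le> n \<Longrightarrow> ?X n < ereal B"
      using Limsup_lessD by (fastforce simp: eventually_sequentially)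
    \<comment> \<open>The limsup controls only \<open>n \<ge> N\<close>, whereas \<open>BVV1\<close>
      ranges over all \<open>n \<ge> 1\<close>. The finitely many remaining ratios are nonnegative,
      so their total bounds each of them.\<close>
    define C where "C = \<bar>B\<bar> + (\<Sum>n<N. \<Sum>m\<in>{1..2 ^ n}. R n m)"
    have sum_nonneg': "0 \<le> (\<Sum>m\<in>{1..2 ^ n}. R n m)" for n
      using R_nonneg by (intro sum_nonneg) auto
    then have sum2_nonneg: "0 \<le> (\<Sum>n<N. \<Sum>m\<in>{1..2 ^ n}. R n m)"
      by (rule sum_nonneg)
    have "R n m \<le> C" if m: "1 \<le> m" "m \<le> 2 ^ n" for n m
    proof (cases "N \<le> n")
      case True
      have "ereal (R n m) \<le> ?X n" using m by (intro SUP_upper) auto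
      also have "\<dots> < ereal B" using N True by blast
      finally show ?thesis using sum2_nonneg by (simp add: C_def)
    next
      case False
      have "R n m \<le> (\<Sum>m\<in>{1..2 ^ n}. R n m)"
        using m R_nonneg by (intro member_le_sum) auto
      also have "\<dots> \<le> (\<Sum>n<N. \<Sum>m\<in>{1..2 ^ n}. R n m)"
        using False sum_nonneg' by (intro member_le_sum[of n "{..<N}" "\<lambda>n. \<Sum>m\<in>{1..2 ^ n}. R n m"]) auto
      finally show ?thesis by (simp add: C_def)
    qed
    then have bound: "real k powr (1 / p n) \<le> C * (\<Sum>j=1..k. 1 / lam j)" if "1 \<le> k" "k \<le> 2 ^ n" for n k
      using that L_pos[of k] by (simp add: R_def divide_le_eq L_def)
    have "0 \<le> C" using sum2_nonneg by (simp add: C_def)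
    show "LambdaBV lam \<subseteq> BVsharp p"
    proof
      fix f assume f: "f \<in> LambdaBV lam"
      then have per: "f (x + 1, y) = f (x, y)" "f (x, y + 1) = f (x, y)" for x y
        by (auto simp: LambdaBV_def periodic_measurable_def)
      have fin: "LambdaV1 lam f < \<infinity>" "LambdaV1 lam (f \<circ> prod.swap) < \<infinity>"
        using f by (auto simp: LambdaBV_def less_top simp flip: LambdaV2_eq_LambdaV1_swap)
      have "BVV1 p f < \<infinity>"
        by (rule BVV1_finite_if_LambdaV1_finite[OF per(1) lam fin(1) p \<open>0 \<le> C\<close> bound])
      moreover have "BVV1 p (f \<circ> prod.swap) < \<infinity>"
        by (rule BVV1_finite_if_LambdaV1_finite[OF _ lam fin(2) p \<open>0 \<le> C\<close> bound]) (simp_all add: per)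
      ultimately show "f \<in> BVsharp p"
        using f by (simp add: BVsharp_def LambdaBV_def BVV2_eq_BVV1_swap)
    qed
  next
    assume sub: "LambdaBV lam \<subseteq> BVsharp p"
    have "\<exists>B N M. \<forall>n m. N \<le> n \<longrightarrow> M < m \<longrightarrow> m \<le> 2 ^ n \<longrightarrow> R n m \<le> B"
    proof (rule ccontr)
      assume "\<not> ?thesis"
      then have "\<exists>n m. N \<le> n \<and> M < m \<and> m \<le> 2 ^ n \<and> B < R n m" for B N M
        by (meson not_le)
      then show False
        using LambdaBV_not_subset_BVsharp[of lam p] lam p assms(2) sub unfolding R_def L_def by blast
    qed
    then obtain B N M where B: "\<And>n m. N \<le> n \<Longrightarrow> M < m \<Longrightarrow> m \<le> 2 ^ n \<Longrightarrow> R n m \<le> B"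
      by blast
    \<comment> \<open>\<open>B\<close> covers only \<open>m > M\<close>. For the finitely many
      smaller \<open>m\<close>, the inequality \<open>p n \<ge> 1\<close> bounds
      \<open>R n m\<close> by \<open>real m / L m\<close>, uniformly in
      \<open>n \<ge> 1\<close>.\<close>
    define C where "C = \<bar>B\<bar> + (\<Sum>m\<in>{1..M}. real m / L m)"
    have nonneg: "0 \<le> real m / L m" if "m \<in> {1..M}" for m
      using L_pos[of m] that by simp
    have "R n m \<le> C" if n: "max 1 N \<le> n" and m: "1 \<le> m" "m \<le> 2 ^ n" for n m
    proof (cases "M < m")
      case True
      then have "R n m \<le> B" using B n m by simp
      moreover have "0 \<le> (\<Sum>m\<in>{1..M}. real m / L m)" using nonneg by (rule sum_nonneg)
      ultimately show ?thesis by (simp add: C_def)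
    next
      case False
      have "real m powr (1 / p n) \<le> real m powr 1"
        using p[of n] n m by (intro powr_mono) auto
      then have "R n m \<le> real m / L m"
        using L_pos[OF m(1)] m by (simp add: R_def divide_right_mono)
      also have "\<dots> \<le> (\<Sum>m\<in>{1..M}. real m / L m)"
        using False m nonneg by (intro member_le_sum[of m "{1..M}" "\<lambda>m. real m / L m"]) auto
      finally show ?thesis by (simp add: C_def)
    qed
    then have "eventually (\<lambda>n. ?X n \<le> ereal C) sequentially"
      unfolding eventually_sequentially by (intro exI[of _ "max 1 N"]) (auto intro!: SUP_least)
    then have "limsup ?X \<le> ereal C" by (rule Limsup_bounded)
    then show "limsup ?X < \<infinity>" by (rule le_less_trans) simp
  qed
  then show ?thesis by (simp only: R_def L_def)
qed

end
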